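(* There is no class $\mathscr{F}$ of graphs such that for every two graphs $G$ and $H$, we have that $G$ and $H$ are fractionally isomorphic if and only if $\hom(G,\mathscr{F})=\hom(H,\mathscr{F})$.
   Context: All graphs are finite, undirected and simple (no self-loops, no multi-edges, no weights). A class of graphs means a non-empty collection of graphs closed under isomorphism. A homomorphism from $G$ to $H$ is a map $h:V(G)\to V(H)$ such that $(u,v)\in E(G)$ implies $(h(u),h(v))\in E(H)$; $\hom(G,H)$ denotes the number of homomorphisms from $G$ to $H$. For a class $\mathscr{F}$ of graphs, $\hom(G,\mathscr{F})=(\hom(G,F)\mid F\in\mathscr{F})$ is the right profile of $G$ restricted to $\mathscr{F}$; thus $\hom(G,\mathscr{F})=\hom(H,\mathscr{F})$ means $\hom(G,F)=\hom(H,F)$ for every $F\in\mathscr{F}$. Fractional isomorphism: let $G$ and $H$ be graphs on the same vertex set $V$ (up to renaming of vertices, i.e., graphs with the same number of vertices), with adjacency matrices $A$ and $B$. They are fractionally isomorphic if the system of linear equations $AX=XB$, $Xe=e$, $e^{\top}X=e^{\top}$, where $e$ is the all-ones vector of length $|V|$ and $X$ is an unknown $|V|\times|V|$ matrix, has a solution $X$ with non-negative rational entries. Graphs with different numbers of vertices are not fractionally isomorphic. *)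

theory Defs
  imports Complex_Main "HOL-Library.FuncSet" "Graph_Theory.Graph_Theory"
begin

(* A finite simple undirected graph is a pair_graph: a finite vertex set together with a
   symmetric, irreflexive set of pairs of vertices. The vertex set may be empty. *)

definition homs :: "'a pair_pre_digraph \<Rightarrow> 'b pair_pre_digraph \<Rightarrow> ('a \<Rightarrow> 'b) set" where
  "homs G H = {h \<in> pverts G \<rightarrow>\<^sub>E pverts H. \<forall>u v. (u, v) \<in> parcs G \<longrightarrow> (h u, h v) \<in> parcs H}"

definition hom :: "'a pair_pre_digraph \<Rightarrow> 'b pair_pre_digraph \<Rightarrow> nat" where
  "hom G H = card (homs G H)"

definition right_profile ::
  "'a pair_pre_digraph \<Rightarrow> 'b pair_pre_digraph set \<Rightarrow> 'b pair_pre_digraph \<Rightarrow> nat" where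
  "right_profile G \<F> = restrict (hom G) \<F>"

(* Every finite graph is isomorphic to one whose vertices are natural numbers, so an
   isomorphism-closed class of finite graphs is determined by its members of type
   nat pair_pre_digraph. *)
definition graph_class :: "nat pair_pre_digraph set \<Rightarrow> bool" where
  "graph_class \<F> \<longleftrightarrow> \<F> \<noteq> {} \<and> (\<forall>F \<in> \<F>. pair_graph F) \<and>
     (\<forall>F \<in> \<F>. \<forall>F'. pair_graph F' \<and> digraph_iso (with_proj F) (with_proj F') \<longrightarrow> F' \<in> \<F>)"

definition adj :: "'a pair_pre_digraph \<Rightarrow> 'a \<Rightarrow> 'a \<Rightarrow> rat" where
  "adj G u v = (if (u, v) \<in> parcs G then 1 else 0)"

(* The system A X = X B, X e = e, e^T X = e^T with X >= 0. Matrices are indexed by the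
   vertices themselves: the rows of X by those of G and its columns by those of H, so that
   the vertices of H need not first be renamed to those of G. *)
definition fractionally_isomorphic :: "'a pair_pre_digraph \<Rightarrow> 'b pair_pre_digraph \<Rightarrow> bool" where
  "fractionally_isomorphic G H \<longleftrightarrow>
     card (pverts G) = card (pverts H) \<and>
     (\<exists>X :: 'a \<Rightarrow> 'b \<Rightarrow> rat.
        (\<forall>u \<in> pverts G. \<forall>v \<in> pverts H.
           (\<Sum>w \<in> pverts G. adj G u w * X w v) = (\<Sum>w \<in> pverts H. X u w * adj H w v)) \<and>
        (\<forall>u \<in> pverts G. (\<Sum>v \<in> pverts H. X u v) = 1) \<and>
        (\<forall>v \<in> pverts H. (\<Sum>u \<in> pverts G. X u v) = 1) \<and>
        (\<forall>u \<in> pverts G. \<forall>v \<in> pverts H. 0 \<le> X u v))"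

end

theory Submission
  imports Defs
begin

text \<open>
  A hypothetical class \<open>\<F>\<close> is refuted whether or not one of its members has an edge.

  Suppose that \<open>F \<in> \<F>\<close> has an edge, and choose \<open>n\<close> larger than the number of vertices of \<open>F\<close>.
  The disjoint union of two complete graphs on \<open>n\<close> vertices and the crown graph (the complete
  bipartite graph on \<open>n + n\<close> vertices minus a perfect matching) are both \<open>(n - 1)\<close>-regular on
  \<open>2 * n\<close> vertices, hence fractionally isomorphic: a constant matrix is a solution
  (\<open>regular_imp_fractionally_isomorphic\<close>). Homomorphism counts into \<open>F\<close> tell them apart. The
  crown graph is bipartite and so maps to the edge of \<open>F\<close>, whereas a homomorphism into a loopless
  graph is injective on a clique, and \<open>F\<close> has fewer than \<open>n\<close> vertices (\<open>homs_clique_empty\<close>).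

  If no member of \<open>\<F>\<close> has an edge, then no graph with an edge has a homomorphism into a member of
  \<open>\<F>\<close>, so that all of these graphs have the same profile. Among them are graphs of different
  orders, which are not fractionally isomorphic.
\<close>

lemma sum_adj_out: "finite (pverts G) \<Longrightarrow>
    (\<Sum>w \<in> pverts G. adj G u w) = of_nat (card {w \<in> pverts G. (u, w) \<in> parcs G})"
  by (simp add: adj_def sum.If_cases Int_def)

lemma sum_adj_in: "finite (pverts G) \<Longrightarrow>
    (\<Sum>w \<in> pverts G. adj G w v) = of_nat (card {w \<in> pverts G. (w, v) \<in> parcs G})"
  by (simp add: adj_def sum.If_cases Int_def)

text \<open>
  The constant matrix with entries \<open>1 / card (pverts G)\<close> is doubly stochastic, and its product with
  an adjacency matrix only sees the degrees. The row of \<open>u\<close> on the left of \<open>A X = X B\<close> involves the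
  out-degree of \<open>u\<close>, the column of \<open>v\<close> on the right the in-degree of \<open>v\<close>.
\<close>
lemma regular_imp_fractionally_isomorphic:
  assumes fin: "finite (pverts G)" "finite (pverts H)"
    and card_eq: "card (pverts G) = card (pverts H)"
    and out: "\<And>u. u \<in> pverts G \<Longrightarrow> card {w \<in> pverts G. (u, w) \<in> parcs G} = d"
    and inn: "\<And>v. v \<in> pverts H \<Longrightarrow> card {w \<in> pverts H. (w, v) \<in> parcs H} = d"
  shows "fractionally_isomorphic G H"
proof -
  define c :: rat where "c = 1 / of_nat (card (pverts G))"
  have "(\<Sum>w \<in> pverts G. adj G u w * c) = (\<Sum>w \<in> pverts H. c * adj H w v)"
    if "u \<in> pverts G" "v \<in> pverts H" for u v
    using that fin by
      (simp add: sum_adj_out sum_adj_in out inn flip: sum_distrib_left sum_distrib_right)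
  moreover have "(\<Sum>v \<in> pverts H. c) = 1" if "u \<in> pverts G" for u
    using that fin card_eq by (auto simp: c_def)
  moreover have "(\<Sum>u \<in> pverts G. c) = 1" if "v \<in> pverts H" for v
    using that fin card_eq by (auto simp: c_def)
  moreover have "0 \<le> c"
    by (simp add: c_def)
  ultimately show ?thesis
    unfolding fractionally_isomorphic_def using card_eq by (intro conjI exI[of _ "\<lambda>_ _. c"]) auto
qed

lemma hom_eq_0_iff:
  assumes "finite (pverts G)" "finite (pverts F)"
  shows "hom G F = 0 \<longleftrightarrow> homs G F = {}"
proof -
  have "finite (homs G F)"
    by (rule finite_subset[OF _ finite_PiE[OF assms(1), of "\<lambda>_. pverts F"]])
      (use assms in \<open>auto simp: homs_def\<close>)
  then show ?thesis
    by (simp add: hom_def)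
qed

text \<open>Without loops in \<open>F\<close>, adjacent vertices have distinct images, so a clique embeds into \<open>F\<close>.\<close>
lemma homs_clique_empty:
  assumes F: "finite (pverts F)" "\<And>x. (x, x) \<notin> parcs F"
    and K: "K \<subseteq> pverts G" "\<And>u v. u \<in> K \<Longrightarrow> v \<in> K \<Longrightarrow> u \<noteq> v \<Longrightarrow> (u, v) \<in> parcs G"
    and big: "card (pverts F) < card K"
  shows "homs G F = {}"
proof (rule ccontr)
  assume "homs G F \<noteq> {}"
  then obtain h where h: "h \<in> pverts G \<rightarrow> pverts F"
      "\<And>u v. (u, v) \<in> parcs G \<Longrightarrow> (h u, h v) \<in> parcs F"
    by (auto simp: homs_def)
  have "inj_on h K"
  proof (rule inj_onI)
    fix u v assume "u \<in> K" "v \<in> K" "h u = h v"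
    then show "u = v"
      using K(2)[of u v] h(2)[of u v] F(2) by auto
  qed
  moreover have "h ` K \<subseteq> pverts F"
    using h(1) K(1) by auto
  ultimately have "card K \<le> card (pverts F)"
    using F(1) by (rule card_inj_on_le)
  then show False
    using big by simp
qed

lemma homs_bipartite_nonempty:
  assumes "pair_graph F" "(a, b) \<in> parcs F"
    and col: "\<And>u v. (u, v) \<in> parcs G \<Longrightarrow> u \<in> pverts G \<and> v \<in> pverts G \<and> (P u \<longleftrightarrow> \<not> P v)"
  shows "homs G F \<noteq> {}"
proof -
  interpret pair_graph F by fact
  have ab: "a \<in> pverts F" "b \<in> pverts F" "(b, a) \<in> parcs F"
    using assms(2) arcs_symmetric arc_fst_in_verts[of "(a, b)"] arc_snd_in_verts[of "(a, b)"]
    by auto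
  have "(\<lambda>u \<in> pverts G. if P u then a else b) \<in> homs G F"
    using ab assms(2) by (auto simp: homs_def dest: col)
  then show ?thesis
    by blast
qed

definition complete :: "nat \<Rightarrow> nat pair_pre_digraph" where
  "complete n = \<lparr>pverts = {..<n}, parcs = {(u, v). u < n \<and> v < n \<and> u \<noteq> v}\<rparr>"

definition two_cliques :: "nat \<Rightarrow> nat pair_pre_digraph" where
  "two_cliques n = \<lparr>pverts = {..<2 * n},
     parcs = {(u, v). u < 2 * n \<and> v < 2 * n \<and> u \<noteq> v \<and> (u < n \<longleftrightarrow> v < n)}\<rparr>"

text \<open>The matching removed from the complete bipartite graph pairs \<open>u < n\<close> with \<open>u + n\<close>.\<close>
definition crown :: "nat \<Rightarrow> nat pair_pre_digraph" where
  "crown n = \<lparr>pverts = {..<2 * n},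
     parcs = {(u, v). u < 2 * n \<and> v < 2 * n \<and> u + n \<noteq> v \<and> v + n \<noteq> u \<and> (u < n \<longleftrightarrow> \<not> v < n)}\<rparr>"

lemma pair_graphI:
  assumes "finite (pverts G)" "parcs G \<subseteq> pverts G \<times> pverts G"
    and "\<And>u. (u, u) \<notin> parcs G" "\<And>u v. (u, v) \<in> parcs G \<Longrightarrow> (v, u) \<in> parcs G"
  shows "pair_graph G"
proof
  show "finite (parcs G)"
    using assms(1,2) by (blast intro: finite_subset)
qed (use assms in \<open>auto simp: symmetric_def intro!: symI\<close>)

lemma pair_graph_complete: "pair_graph (complete n)"
  by (rule pair_graphI) (auto simp: complete_def)

lemma pair_graph_two_cliques: "pair_graph (two_cliques n)"
  by (rule pair_graphI) (auto simp: two_cliques_def)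

lemma pair_graph_crown: "pair_graph (crown n)"
  by (rule pair_graphI) (auto simp: crown_def)

lemma fractionally_isomorphic_two_cliques_crown:
  "fractionally_isomorphic (two_cliques n) (crown n)"
proof (rule regular_imp_fractionally_isomorphic[where d = "n - 1"])
  fix u assume "u \<in> pverts (two_cliques n)"
  then have u: "u < 2 * n"
    by (simp add: two_cliques_def)
  then have "{w \<in> pverts (two_cliques n). (u, w) \<in> parcs (two_cliques n)} =
      (if u < n then {..<n} else {n..<2 * n}) - {u}"
    by (auto simp: two_cliques_def)
  then show "card {w \<in> pverts (two_cliques n). (u, w) \<in> parcs (two_cliques n)} = n - 1"
    using u by simp
next
  fix v assume "v \<in> pverts (crown n)"
  then have v: "v < 2 * n"
    by (simp add: crown_def)
  then have "{w \<in> pverts (crown n). (w, v) \<in> parcs (crown n)} =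
      (if v < n then {n..<2 * n} - {v + n} else {..<n} - {v - n})"
    by (auto simp: crown_def)
  then show "card {w \<in> pverts (crown n). (w, v) \<in> parcs (crown n)} = n - 1"
    using v by (cases "v < n") auto
qed (simp_all add: two_cliques_def crown_def)

theorem theorem7:
  shows "\<not> (\<exists>\<F> :: nat pair_pre_digraph set. graph_class \<F> \<and>
    (\<forall>(G :: nat pair_pre_digraph) (H :: nat pair_pre_digraph). pair_graph G \<longrightarrow> pair_graph H \<longrightarrow>
      (fractionally_isomorphic G H \<longleftrightarrow> right_profile G \<F> = right_profile H \<F>)))"
proof
  assume "\<exists>\<F> :: nat pair_pre_digraph set. graph_class \<F> \<and>
    (\<forall>(G :: nat pair_pre_digraph) (H :: nat pair_pre_digraph). pair_graph G \<longrightarrow> pair_graph H \<longrightarrow>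
      (fractionally_isomorphic G H \<longleftrightarrow> right_profile G \<F> = right_profile H \<F>))"
  then obtain \<F> :: "nat pair_pre_digraph set" where
    cls: "graph_class \<F>" and
    equiv: "\<forall>(G :: nat pair_pre_digraph) (H :: nat pair_pre_digraph).
      pair_graph G \<longrightarrow> pair_graph H \<longrightarrow>
      (fractionally_isomorphic G H \<longleftrightarrow> right_profile G \<F> = right_profile H \<F>)"
    by (elim exE conjE)
  note char = equiv[rule_format]
  have graphs: "pair_graph F" if "F \<in> \<F>" for F
    using cls that by (simp add: graph_class_def)
  have edgeless: "parcs F = {}" if F: "F \<in> \<F>" for F
  proof (rule ccontr)
    assume "parcs F \<noteq> {}"
    then obtain a b where ab: "(a, b) \<in> parcs F"
      by auto
    interpret pair_graph F
      using F by (rule graphs)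
    define n where "n = Suc (card (pverts F))"
    have "right_profile (two_cliques n) \<F> = right_profile (crown n) \<F>"
      by (rule iffD1[OF char[OF pair_graph_two_cliques pair_graph_crown]
            fractionally_isomorphic_two_cliques_crown])
    then have "right_profile (two_cliques n) \<F> F = right_profile (crown n) \<F> F"
      by (rule fun_cong)
    then have "hom (two_cliques n) F = hom (crown n) F"
      using F by (simp add: right_profile_def)
    moreover have "hom (two_cliques n) F = 0"
    proof -
      have "homs (two_cliques n) F = {}"
      proof (rule homs_clique_empty)
        show "(x, x) \<notin> parcs F" for x
          using pair_no_loops[of "(x, x)"] by auto
        show "card (pverts F) < card {..<n}"
          by (simp add: n_def)
      qed (auto simp: two_cliques_def pair_finite_verts)
      then show ?thesis
        by (simp add: hom_def)
    qed
    moreover have "hom (crown n) F \<noteq> 0"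
    proof -
      have "homs (crown n) F \<noteq> {}"
        by (rule homs_bipartite_nonempty[where P = "\<lambda>u. u < n", OF graphs[OF F] ab])
          (auto simp: crown_def)
      moreover have "finite (pverts (crown n))"
        by (simp add: crown_def)
      ultimately show ?thesis
        using hom_eq_0_iff pair_finite_verts by blast
    qed
    ultimately show False
      by simp
  qed
  have no_hom: "hom (complete n) F = 0" if "F \<in> \<F>" "2 \<le> n" for F n
  proof -
    have "(0, 1) \<in> parcs (complete n)"
      using that by (simp add: complete_def)
    then have "homs (complete n) F = {}"
      using edgeless[OF that(1)] by (auto simp: homs_def)
    then show ?thesis
      by (simp add: hom_def)
  qed
  have "right_profile (complete 2) \<F> = right_profile (complete 3) \<F>"
    unfolding right_profile_def by (rule restrict_ext) (simp add: no_hom)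
  then have "fractionally_isomorphic (complete 2) (complete 3)"
    by (rule iffD2[OF char[OF pair_graph_complete pair_graph_complete]])
  then have "card (pverts (complete 2)) = card (pverts (complete 3))"
    unfolding fractionally_isomorphic_def by (rule conjunct1)
  then show False
    by (simp add: complete_def)
qed

end
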